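(* Let $R$ be a commutative ring with unity and let $S\subseteq R$ be a multiplicatively closed subset. If $R$ is an $S$-integral domain, then the localization $S^{-1}R$ is an integral domain.
   Context: A multiplicatively closed subset $S$ of a commutative ring $R$ is a subset with $1\in S$, $0\notin S$, and $st\in S$ for all $s,t\in S$. The ring $R$ is an $S$-integral domain if there exists $s\in S$ such that for all $a,b\in R$ with $ab=0$, either $sa=0$ or $sb=0$. *)

theory Defs
  imports "HOL-Algebra.Algebra"
begin

definition mult_closed_subset :: "('a, 'b) ring_scheme \<Rightarrow> 'a set \<Rightarrow> bool"
  where "mult_closed_subset R S \<longleftrightarrow> submonoid S R \<and> \<zero>\<^bsub>R\<^esub> \<notin> S"

definition S_integral_domain :: "('a, 'b) ring_scheme \<Rightarrow> 'a set \<Rightarrow> bool"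
  where "S_integral_domain R S \<longleftrightarrow>
    (\<exists>s\<in>S. \<forall>a\<in>carrier R. \<forall>b\<in>carrier R.
      a \<otimes>\<^bsub>R\<^esub> b = \<zero>\<^bsub>R\<^esub> \<longrightarrow> s \<otimes>\<^bsub>R\<^esub> a = \<zero>\<^bsub>R\<^esub> \<or> s \<otimes>\<^bsub>R\<^esub> b = \<zero>\<^bsub>R\<^esub>)"

(* Since R may have zero divisors, equality of the fractions a/s and b/t is
   u(ta - sb) = 0 for some u in S; without the factor u the relation need not be transitive. *)
definition fraction_rel :: "('a, 'b) ring_scheme \<Rightarrow> 'a set \<Rightarrow> (('a \<times> 'a) \<times> ('a \<times> 'a)) set"
  where "fraction_rel R S =
    {((a, s), (b, t)). (a, s) \<in> carrier R \<times> S \<and> (b, t) \<in> carrier R \<times> S \<and>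
      (\<exists>u\<in>S. u \<otimes>\<^bsub>R\<^esub> (t \<otimes>\<^bsub>R\<^esub> a \<ominus>\<^bsub>R\<^esub> s \<otimes>\<^bsub>R\<^esub> b) = \<zero>\<^bsub>R\<^esub>)}"

definition fraction :: "('a, 'b) ring_scheme \<Rightarrow> 'a set \<Rightarrow> 'a \<Rightarrow> 'a \<Rightarrow> ('a \<times> 'a) set"
  where "fraction R S a s = fraction_rel R S `` {(a, s)}"

(* The unions in the operations range over all representatives of the classes C and D; every pair of
   representatives yields the same class; see localization_mult and localization_add below. *)
definition localization :: "('a, 'b) ring_scheme \<Rightarrow> 'a set \<Rightarrow> ('a \<times> 'a) set ring"
  where "localization R S =
    \<lparr>carrier = (carrier R \<times> S) // fraction_rel R S,
     monoid.mult = (\<lambda>C D. \<Union>(a, s)\<in>C. \<Union>(b, t)\<in>D. fraction R S (a \<otimes>\<^bsub>R\<^esub> b) (s \<otimes>\<^bsub>R\<^esub> t)),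
     monoid.one = fraction R S \<one>\<^bsub>R\<^esub> \<one>\<^bsub>R\<^esub>,
     ring.zero = fraction R S \<zero>\<^bsub>R\<^esub> \<one>\<^bsub>R\<^esub>,
     ring.add = (\<lambda>C D. \<Union>(a, s)\<in>C. \<Union>(b, t)\<in>D.
       fraction R S (t \<otimes>\<^bsub>R\<^esub> a \<oplus>\<^bsub>R\<^esub> s \<otimes>\<^bsub>R\<^esub> b) (s \<otimes>\<^bsub>R\<^esub> t))\<rparr>"

context cring
begin

lemma fraction_rel_iff:
  assumes "submonoid S R" "a \<in> carrier R" "s \<in> S" "b \<in> carrier R" "t \<in> S"
  shows "((a, s), (b, t)) \<in> fraction_rel R S \<longleftrightarrow> (\<exists>u\<in>S. u \<otimes> (t \<otimes> a) = u \<otimes> (s \<otimes> b))"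
proof -
  have S: "S \<subseteq> carrier R"
    using assms(1) by (rule submonoid.subset)
  have "u \<otimes> (t \<otimes> a \<ominus> s \<otimes> b) = u \<otimes> (t \<otimes> a) \<ominus> u \<otimes> (s \<otimes> b)" if "u \<in> S" for u
    using assms(2-5) S that by (auto simp: r_distr r_minus minus_eq subset_iff)
  moreover have "u \<otimes> (t \<otimes> a) \<ominus> u \<otimes> (s \<otimes> b) = \<zero> \<longleftrightarrow> u \<otimes> (t \<otimes> a) = u \<otimes> (s \<otimes> b)"
    if "u \<in> S" for u
    using assms(2-5) S that by (auto simp: subset_iff)
  ultimately show ?thesis
    using assms(2-5) by (auto simp: fraction_rel_def)
qed

lemma fraction_rel_equiv:
  assumes "submonoid S R"
  shows "equiv (carrier R \<times> S) (fraction_rel R S)"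
proof -
  have S: "S \<subseteq> carrier R" "\<one> \<in> S" "\<And>x y. \<lbrakk>x \<in> S; y \<in> S\<rbrakk> \<Longrightarrow> x \<otimes> y \<in> S"
    using assms by (auto simp: submonoid_def)
  show ?thesis
  proof (rule equivI)
    show "fraction_rel R S \<subseteq> (carrier R \<times> S) \<times> (carrier R \<times> S)"
      by (auto simp: fraction_rel_def)
    show "refl_on (carrier R \<times> S) (fraction_rel R S)"
      using S assms by (auto simp: refl_on_def fraction_rel_iff)
    show "sym (fraction_rel R S)"
    proof (rule symI, clarify)
      fix a s b t
      assume *: "((a, s), (b, t)) \<in> fraction_rel R S"
      then have "a \<in> carrier R" "s \<in> S" "b \<in> carrier R" "t \<in> S"
        by (auto simp: fraction_rel_def)
      with * assms show "((b, t), (a, s)) \<in> fraction_rel R S"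
        by (metis fraction_rel_iff)
    qed
    show "trans (fraction_rel R S)"
    proof (rule transI, clarify)
      fix a s b t c r
      assume 1: "((a, s), (b, t)) \<in> fraction_rel R S" and 2: "((b, t), (c, r)) \<in> fraction_rel R S"
      then have mem: "a \<in> carrier R" "s \<in> S" "b \<in> carrier R" "t \<in> S" "c \<in> carrier R" "r \<in> S"
        by (auto simp: fraction_rel_def)
      obtain u v where u: "u \<in> S" "u \<otimes> (t \<otimes> a) = u \<otimes> (s \<otimes> b)"
        and v: "v \<in> S" "v \<otimes> (r \<otimes> b) = v \<otimes> (t \<otimes> c)"
        using 1 2 mem assms by (auto simp: fraction_rel_iff)
      have car: "s \<in> carrier R" "t \<in> carrier R" "r \<in> carrier R" "u \<in> carrier R" "v \<in> carrier R"
        using mem u v S by auto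
      have "(u \<otimes> v \<otimes> t) \<otimes> (r \<otimes> a) = v \<otimes> r \<otimes> (u \<otimes> (t \<otimes> a))"
        using mem car by (simp add: m_ac)
      also have "\<dots> = u \<otimes> s \<otimes> (v \<otimes> (r \<otimes> b))"
        using mem car unfolding u by (simp add: m_ac)
      also have "\<dots> = (u \<otimes> v \<otimes> t) \<otimes> (s \<otimes> c)"
        using mem car unfolding v by (simp add: m_ac)
      finally show "((a, s), (c, r)) \<in> fraction_rel R S"
        using mem u v S assms by (auto simp: fraction_rel_iff)
    qed
  qed
qed

lemma localization_mult:
  assumes "submonoid S R" "a \<in> carrier R" "s \<in> S" "b \<in> carrier R" "t \<in> S"
  shows "fraction R S a s \<otimes>\<^bsub>localization R S\<^esub> fraction R S b t = fraction R S (a \<otimes> b) (s \<otimes> t)"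
proof -
  have S: "S \<subseteq> carrier R" "\<And>x y. \<lbrakk>x \<in> S; y \<in> S\<rbrakk> \<Longrightarrow> x \<otimes> y \<in> S"
    using assms(1) by (auto simp: submonoid_def)
  note eqv = fraction_rel_equiv[OF assms(1)]
  let ?f = "\<lambda>(a, s) (b, t). fraction R S (a \<otimes> b) (s \<otimes> t)"
  have "congruent2 (fraction_rel R S) (fraction_rel R S) ?f"
  proof (rule congruent2I', clarify)
    fix a s a' s' b t b' t'
    assume 1: "((a, s), (a', s')) \<in> fraction_rel R S" and 2: "((b, t), (b', t')) \<in> fraction_rel R S"
    then have mem: "a \<in> carrier R" "s \<in> S" "a' \<in> carrier R" "s' \<in> S"
      "b \<in> carrier R" "t \<in> S" "b' \<in> carrier R" "t' \<in> S"
      by (auto simp: fraction_rel_def)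
    obtain u v where u: "u \<in> S" "u \<otimes> (s' \<otimes> a) = u \<otimes> (s \<otimes> a')"
      and v: "v \<in> S" "v \<otimes> (t' \<otimes> b) = v \<otimes> (t \<otimes> b')"
      using 1 2 mem assms(1) by (auto simp: fraction_rel_iff)
    have car: "s \<in> carrier R" "t \<in> carrier R" "s' \<in> carrier R" "t' \<in> carrier R"
      "u \<in> carrier R" "v \<in> carrier R"
      using mem u v S by auto
    have "(u \<otimes> v) \<otimes> ((s' \<otimes> t') \<otimes> (a \<otimes> b)) = (u \<otimes> (s' \<otimes> a)) \<otimes> (v \<otimes> (t' \<otimes> b))"
      using mem car by (simp add: m_ac)
    also have "\<dots> = (u \<otimes> v) \<otimes> ((s \<otimes> t) \<otimes> (a' \<otimes> b'))"
      using mem car unfolding u v by (simp add: m_ac)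
    finally have "((a \<otimes> b, s \<otimes> t), (a' \<otimes> b', s' \<otimes> t')) \<in> fraction_rel R S"
      using mem u v S assms(1) by (auto simp: fraction_rel_iff)
    then show "fraction R S (a \<otimes> b) (s \<otimes> t) = fraction R S (a' \<otimes> b') (s' \<otimes> t')"
      unfolding fraction_def by (rule equiv_class_eq[OF eqv])
  qed
  from UN_equiv_class2[OF eqv eqv this, of "(a, s)" "(b, t)"] assms(2-5)
  show ?thesis
    by (simp add: localization_def fraction_def[of R S a] fraction_def[of R S b] split_def)
qed

lemma localization_add:
  assumes "submonoid S R" "a \<in> carrier R" "s \<in> S" "b \<in> carrier R" "t \<in> S"
  shows "fraction R S a s \<oplus>\<^bsub>localization R S\<^esub> fraction R S b t
    = fraction R S (t \<otimes> a \<oplus> s \<otimes> b) (s \<otimes> t)"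
proof -
  have S: "S \<subseteq> carrier R" "\<And>x y. \<lbrakk>x \<in> S; y \<in> S\<rbrakk> \<Longrightarrow> x \<otimes> y \<in> S"
    using assms(1) by (auto simp: submonoid_def)
  note eqv = fraction_rel_equiv[OF assms(1)]
  let ?f = "\<lambda>(a, s) (b, t). fraction R S (t \<otimes> a \<oplus> s \<otimes> b) (s \<otimes> t)"
  have "congruent2 (fraction_rel R S) (fraction_rel R S) ?f"
  proof (rule congruent2I', clarify)
    fix a s a' s' b t b' t'
    assume 1: "((a, s), (a', s')) \<in> fraction_rel R S" and 2: "((b, t), (b', t')) \<in> fraction_rel R S"
    then have mem: "a \<in> carrier R" "s \<in> S" "a' \<in> carrier R" "s' \<in> S"
      "b \<in> carrier R" "t \<in> S" "b' \<in> carrier R" "t' \<in> S"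
      by (auto simp: fraction_rel_def)
    obtain u v where u: "u \<in> S" "u \<otimes> (s' \<otimes> a) = u \<otimes> (s \<otimes> a')"
      and v: "v \<in> S" "v \<otimes> (t' \<otimes> b) = v \<otimes> (t \<otimes> b')"
      using 1 2 mem assms(1) by (auto simp: fraction_rel_iff)
    have car: "s \<in> carrier R" "t \<in> carrier R" "s' \<in> carrier R" "t' \<in> carrier R"
      "u \<in> carrier R" "v \<in> carrier R"
      using mem u v S by auto
    have "(u \<otimes> v) \<otimes> ((s' \<otimes> t') \<otimes> (t \<otimes> a \<oplus> s \<otimes> b))
        = (v \<otimes> (t' \<otimes> t)) \<otimes> (u \<otimes> (s' \<otimes> a)) \<oplus> (u \<otimes> (s' \<otimes> s)) \<otimes> (v \<otimes> (t' \<otimes> b))"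
      using mem car by (simp add: r_distr m_ac)
    also have "\<dots> = (u \<otimes> v) \<otimes> ((s \<otimes> t) \<otimes> (t' \<otimes> a' \<oplus> s' \<otimes> b'))"
      using mem car unfolding u v by (simp add: r_distr m_ac)
    finally have "((t \<otimes> a \<oplus> s \<otimes> b, s \<otimes> t), (t' \<otimes> a' \<oplus> s' \<otimes> b', s' \<otimes> t')) \<in> fraction_rel R S"
      using mem car u v S assms(1) by (auto simp: fraction_rel_iff)
    then show "fraction R S (t \<otimes> a \<oplus> s \<otimes> b) (s \<otimes> t)
        = fraction R S (t' \<otimes> a' \<oplus> s' \<otimes> b') (s' \<otimes> t')"
      unfolding fraction_def by (rule equiv_class_eq[OF eqv])
  qed
  from UN_equiv_class2[OF eqv eqv this, of "(a, s)" "(b, t)"] assms(2-5)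
  show ?thesis
    by (simp add: localization_def fraction_def[of R S a] fraction_def[of R S b] split_def)
qed

end

end

theory Submission
  imports Defs
begin

text \<open>
  The localization at a submonoid is a commutative ring by the usual fraction arithmetic. A
  fraction \<open>a/s\<close> is zero exactly when some element of \<open>S\<close> annihilates \<open>a\<close>
  (\<open>fraction_eq_zero_iff\<close>). Hence \<open>1/1 \<noteq> 0/1\<close>, since an element of \<open>S\<close> annihilating \<open>1\<close> would
  be \<open>0\<close>. If \<open>(a/s)(b/t) = 0\<close>, then \<open>u a b = 0\<close> for some \<open>u\<close> in \<open>S\<close>; applied to the product of
  \<open>u a\<close> and \<open>b\<close>, the \<open>S\<close>-integrality of \<open>R\<close> gives \<open>r \<in> S\<close> with \<open>(r u) a = 0\<close> or \<open>r b = 0\<close>.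
  As \<open>r u\<close> and \<open>r\<close> both lie in \<open>S\<close>, one of the two fractions is zero.
\<close>

context cring
begin

lemma fraction_eq_iff:
  assumes "submonoid S R" "a \<in> carrier R" "s \<in> S" "b \<in> carrier R" "t \<in> S"
  shows "fraction R S a s = fraction R S b t \<longleftrightarrow> (\<exists>u\<in>S. u \<otimes> (t \<otimes> a) = u \<otimes> (s \<otimes> b))"
proof -
  have "fraction R S a s = fraction R S b t \<longleftrightarrow> ((a, s), (b, t)) \<in> fraction_rel R S"
    unfolding fraction_def
    using assms by (intro eq_equiv_class_iff[OF fraction_rel_equiv]) auto
  then show ?thesis
    using fraction_rel_iff[OF assms] by simp
qed

text \<open>
  The form of equality that the ring axioms need: there the two sides become literally equal
  after cross multiplication, without a further factor from \<open>S\<close>.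
\<close>

lemma fraction_eqI:
  assumes "submonoid S R" "a \<in> carrier R" "s \<in> S" "b \<in> carrier R" "t \<in> S"
    and "t \<otimes> a = s \<otimes> b"
  shows "fraction R S a s = fraction R S b t"
  using assms submonoid.one_closed[OF assms(1)] by (auto simp: fraction_eq_iff)

lemma fraction_eq_zero_iff:
  assumes "submonoid S R" "a \<in> carrier R" "s \<in> S"
  shows "fraction R S a s = \<zero>\<^bsub>localization R S\<^esub> \<longleftrightarrow> (\<exists>u\<in>S. u \<otimes> a = \<zero>)"
proof -
  have S: "S \<subseteq> carrier R" "\<one> \<in> S"
    using assms(1) by (auto simp: submonoid_def)
  have "fraction R S a s = \<zero>\<^bsub>localization R S\<^esub> \<longleftrightarrow> (\<exists>u\<in>S. u \<otimes> (\<one> \<otimes> a) = u \<otimes> (s \<otimes> \<zero>))"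
    using assms S by (simp add: localization_def fraction_eq_iff)
  also have "\<dots> \<longleftrightarrow> (\<exists>u\<in>S. u \<otimes> a = \<zero>)"
    using assms S by (intro bex_cong) (auto simp: subset_iff)
  finally show ?thesis .
qed

lemma localization_one: "\<one>\<^bsub>localization R S\<^esub> = fraction R S \<one> \<one>"
  by (simp add: localization_def)

lemma localization_zero: "\<zero>\<^bsub>localization R S\<^esub> = fraction R S \<zero> \<one>"
  by (simp add: localization_def)

lemma fraction_in_localization:
  assumes "a \<in> carrier R" "s \<in> S"
  shows "fraction R S a s \<in> carrier (localization R S)"
  using assms by (auto simp: localization_def fraction_def intro: quotientI)

lemma localization_cases:
  assumes "x \<in> carrier (localization R S)"
  obtains a s where "a \<in> carrier R" "s \<in> S" "x = fraction R S a s"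
  using assms by (auto simp: localization_def fraction_def elim!: quotientE)

lemma localization_comm_monoid:
  assumes "submonoid S R"
  shows "comm_monoid (localization R S)"
proof -
  have S: "\<And>x. x \<in> S \<Longrightarrow> x \<in> carrier R" "\<one> \<in> S" "\<And>x y. \<lbrakk>x \<in> S; y \<in> S\<rbrakk> \<Longrightarrow> x \<otimes> y \<in> S"
    using assms by (auto simp: submonoid_def)
  note L = localization_mult[OF assms] localization_one
  show ?thesis
  proof (rule comm_monoidI)
    fix x y assume "x \<in> carrier (localization R S)" "y \<in> carrier (localization R S)"
    then show "x \<otimes>\<^bsub>localization R S\<^esub> y \<in> carrier (localization R S)"
      by (elim localization_cases) (simp add: L S fraction_in_localization)
  next
    show "\<one>\<^bsub>localization R S\<^esub> \<in> carrier (localization R S)"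
      by (simp add: L S fraction_in_localization)
  next
    fix x y z
    assume "x \<in> carrier (localization R S)" "y \<in> carrier (localization R S)"
      "z \<in> carrier (localization R S)"
    then show "x \<otimes>\<^bsub>localization R S\<^esub> y \<otimes>\<^bsub>localization R S\<^esub> z
        = x \<otimes>\<^bsub>localization R S\<^esub> (y \<otimes>\<^bsub>localization R S\<^esub> z)"
      by (elim localization_cases) (simp add: L S m_assoc)
  next
    fix x assume "x \<in> carrier (localization R S)"
    then show "\<one>\<^bsub>localization R S\<^esub> \<otimes>\<^bsub>localization R S\<^esub> x = x"
      by (elim localization_cases) (simp add: L S)
  next
    fix x y assume "x \<in> carrier (localization R S)" "y \<in> carrier (localization R S)"
    then show "x \<otimes>\<^bsub>localization R S\<^esub> y = y \<otimes>\<^bsub>localization R S\<^esub> x"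
      by (elim localization_cases) (simp add: L S m_comm)
  qed
qed

lemma localization_abelian_group:
  assumes "submonoid S R"
  shows "abelian_group (localization R S)"
proof -
  have S: "\<And>x. x \<in> S \<Longrightarrow> x \<in> carrier R" "\<one> \<in> S" "\<And>x y. \<lbrakk>x \<in> S; y \<in> S\<rbrakk> \<Longrightarrow> x \<otimes> y \<in> S"
    using assms by (auto simp: submonoid_def)
  note L = localization_add[OF assms] localization_zero
  show ?thesis
  proof (rule abelian_groupI)
    fix x y assume "x \<in> carrier (localization R S)" "y \<in> carrier (localization R S)"
    then show "x \<oplus>\<^bsub>localization R S\<^esub> y \<in> carrier (localization R S)"
      by (elim localization_cases) (simp add: L S fraction_in_localization)
  next
    show "\<zero>\<^bsub>localization R S\<^esub> \<in> carrier (localization R S)"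
      by (simp add: L S fraction_in_localization)
  next
    fix x y z
    assume "x \<in> carrier (localization R S)" "y \<in> carrier (localization R S)"
      "z \<in> carrier (localization R S)"
    then show "x \<oplus>\<^bsub>localization R S\<^esub> y \<oplus>\<^bsub>localization R S\<^esub> z
        = x \<oplus>\<^bsub>localization R S\<^esub> (y \<oplus>\<^bsub>localization R S\<^esub> z)"
      by (elim localization_cases) (simp add: L S r_distr m_ac a_ac)
  next
    fix x y assume "x \<in> carrier (localization R S)" "y \<in> carrier (localization R S)"
    then show "x \<oplus>\<^bsub>localization R S\<^esub> y = y \<oplus>\<^bsub>localization R S\<^esub> x"
      by (elim localization_cases) (simp add: L S m_comm a_comm)
  next
    fix x assume "x \<in> carrier (localization R S)"
    then show "\<zero>\<^bsub>localization R S\<^esub> \<oplus>\<^bsub>localization R S\<^esub> x = x"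
      by (elim localization_cases) (simp add: L S)
  next
    fix x assume "x \<in> carrier (localization R S)"
    then obtain a s where x: "a \<in> carrier R" "s \<in> S" "x = fraction R S a s"
      by (rule localization_cases)
    have "fraction R S (\<ominus> a) s \<oplus>\<^bsub>localization R S\<^esub> x = fraction R S \<zero> (s \<otimes> s)"
      using x S by (simp add: L r_minus l_neg)
    also have "\<dots> = \<zero>\<^bsub>localization R S\<^esub>"
      unfolding localization_zero using x S by (intro fraction_eqI[OF assms]) auto
    finally show "\<exists>y\<in>carrier (localization R S). y \<oplus>\<^bsub>localization R S\<^esub> x = \<zero>\<^bsub>localization R S\<^esub>"
      using x by (auto intro!: fraction_in_localization)
  qed
qed

theorem localization_cring:
  assumes "submonoid S R"
  shows "cring (localization R S)"
proof (rule cringI)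
  have S: "\<And>x. x \<in> S \<Longrightarrow> x \<in> carrier R" "\<And>x y. \<lbrakk>x \<in> S; y \<in> S\<rbrakk> \<Longrightarrow> x \<otimes> y \<in> S"
    using assms by (auto simp: submonoid_def)
  note L = localization_add[OF assms] localization_mult[OF assms]
  show "abelian_group (localization R S)"
    using assms by (rule localization_abelian_group)
  show "comm_monoid (localization R S)"
    using assms by (rule localization_comm_monoid)
  fix x y z
  assume "x \<in> carrier (localization R S)" "y \<in> carrier (localization R S)"
    "z \<in> carrier (localization R S)"
  then obtain a s b t c r where mem: "a \<in> carrier R" "s \<in> S" "b \<in> carrier R" "t \<in> S"
      "c \<in> carrier R" "r \<in> S"
    and xyz: "x = fraction R S a s" "y = fraction R S b t" "z = fraction R S c r"
    by (elim localization_cases)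
  \<comment> \<open>The two sides have different denominators, \<open>s t r\<close> and \<open>s t r\<^sup>2\<close>.\<close>
  have "fraction R S ((t \<otimes> a \<oplus> s \<otimes> b) \<otimes> c) (s \<otimes> t \<otimes> r)
      = fraction R S (t \<otimes> r \<otimes> (a \<otimes> c) \<oplus> s \<otimes> r \<otimes> (b \<otimes> c)) (s \<otimes> r \<otimes> (t \<otimes> r))"
    using mem S by (intro fraction_eqI[OF assms]) (simp_all add: l_distr r_distr m_ac)
  then show "(x \<oplus>\<^bsub>localization R S\<^esub> y) \<otimes>\<^bsub>localization R S\<^esub> z
      = x \<otimes>\<^bsub>localization R S\<^esub> z \<oplus>\<^bsub>localization R S\<^esub> y \<otimes>\<^bsub>localization R S\<^esub> z"
    using mem S by (simp add: xyz L)
qed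

end

theorem proposition2p11:
  fixes R (structure) and S
  assumes "cring R"
    and "mult_closed_subset R S"
    and "S_integral_domain R S"
  shows "domain (localization R S)"
proof -
  interpret cring R by fact
  have sub: "submonoid S R" and zero: "\<zero> \<notin> S"
    using assms(2) by (auto simp: mult_closed_subset_def)
  have S: "\<And>x. x \<in> S \<Longrightarrow> x \<in> carrier R" "\<one> \<in> S" "\<And>x y. \<lbrakk>x \<in> S; y \<in> S\<rbrakk> \<Longrightarrow> x \<otimes> y \<in> S"
    using sub by (auto simp: submonoid_def)
  obtain r where r: "r \<in> S"
    and r_annihilates: "\<And>a b. \<lbrakk>a \<in> carrier R; b \<in> carrier R; a \<otimes> b = \<zero>\<rbrakk>
      \<Longrightarrow> r \<otimes> a = \<zero> \<or> r \<otimes> b = \<zero>"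
    using assms(3) by (auto simp: S_integral_domain_def)
  have "\<one>\<^bsub>localization R S\<^esub> \<noteq> \<zero>\<^bsub>localization R S\<^esub>"
    using zero S by (auto simp: localization_one fraction_eq_zero_iff[OF sub])
  moreover have "x = \<zero>\<^bsub>localization R S\<^esub> \<or> y = \<zero>\<^bsub>localization R S\<^esub>"
    if xy: "x \<otimes>\<^bsub>localization R S\<^esub> y = \<zero>\<^bsub>localization R S\<^esub>"
      "x \<in> carrier (localization R S)" "y \<in> carrier (localization R S)" for x y
  proof -
    obtain a s where x: "a \<in> carrier R" "s \<in> S" "x = fraction R S a s"
      using xy(2) by (rule localization_cases)
    obtain b t where y: "b \<in> carrier R" "t \<in> S" "y = fraction R S b t"
      using xy(3) by (rule localization_cases)
    have "fraction R S (a \<otimes> b) (s \<otimes> t) = \<zero>\<^bsub>localization R S\<^esub>"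
      using xy(1) x y by (simp add: localization_mult[OF sub])
    then obtain u where u: "u \<in> S" "u \<otimes> (a \<otimes> b) = \<zero>"
      using x y S by (auto simp: fraction_eq_zero_iff[OF sub])
    then have "(u \<otimes> a) \<otimes> b = \<zero>"
      using x y S by (simp add: m_assoc)
    then have "r \<otimes> (u \<otimes> a) = \<zero> \<or> r \<otimes> b = \<zero>"
      using x y u S by (intro r_annihilates) auto
    then have "(r \<otimes> u) \<otimes> a = \<zero> \<or> r \<otimes> b = \<zero>"
      using x u r S by (simp add: m_assoc)
    then show ?thesis
      using x y u r S by (auto simp: fraction_eq_zero_iff[OF sub])
  qed
  ultimately show ?thesis
    by (intro domain.intro localization_cring[OF sub] domain_axioms.intro)
qed

end
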